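(* For every representable numerical semigroup $\mathcal{S}$ and every integer $k\geq 1$, the quotient semigroup $\mathcal{S}/k=\{\ell\in\mathbb{N}: k\ell\in\mathcal{S}\}$ is representable.
   Context: A numerical semigroup is a submonoid of $\mathbb{N}=\{0,1,2,\dots\}$ with finite complement. Representable semigroups. For a normal weighted homogeneous surface singularity $(X,0)$ (germ at the origin of an affine surface with good effective $\mathbb{C}^*$-action, so that its coordinate ring is graded, $R_X=\bigoplus_{\ell\geq 0}R_{X,\ell}$) whose link is a rational homology sphere, put $\mathcal{S}_{(X,0)}=\{\ell\geq 0: R_{X,\ell}\neq 0\}$. A numerical semigroup is representable if it equals some such $\mathcal{S}_{(X,0)}$. By Pinkham this is equivalent to the following combinatorial description. An SSR graph $\Gamma$ is a negative definite star-shaped plumbing graph with all genera zero, determined by normalized Seifert invariants $Sf=(-b_0;(\alpha_i,\omega_i)_{i=1}^d)$, where $b_0\in\mathbb{Z}_{>0}$, $d\geq 3$, $0<\omega_i<\alpha_i$, $\gcd(\alpha_i,\omega_i)=1$, and $e:=-b_0+\sum_{i=1}^d\omega_i/\alpha_i<0$ (negative definiteness). Its quasi-linear function is $N(\ell)=b_0\ell-\sum_{i=1}^d\lceil \ell\omega_i/\alpha_i\rceil$, and $\mathcal{S}_\Gamma=\{\ell\in\mathbb{Z}: N(\ell)\geq 0\}$ (contained in $\mathbb{N}$). A numerical semigroup is representable iff it equals $\mathcal{S}_\Gamma$ for some SSR graph $\Gamma$. *)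

theory Defs
  imports Complex_Main
begin

definition numerical_semigroup :: "nat set \<Rightarrow> bool" where
  "numerical_semigroup S \<longleftrightarrow>
     0 \<in> S \<and> (\<forall>x\<in>S. \<forall>y\<in>S. x + y \<in> S) \<and> finite (UNIV - S)"

text \<open>
  A star-shaped plumbing graph with all genera zero is encoded by its normalized Seifert
  invariants \<open>(-b\<^sub>0; (\<alpha>\<^sub>i, \<omega>\<^sub>i)\<^sub>i)\<close>: the field \<open>b0\<close> is the positive number \<open>b\<^sub>0\<close> (not the
  Euler number \<open>-b\<^sub>0\<close> of the central vertex), and \<open>legs\<close> lists the pairs \<open>(\<alpha>\<^sub>i, \<omega>\<^sub>i)\<close>, one
  for each leg, with repetitions allowed.
\<close>

record seifert =
  b0 :: int
  legs :: "(int \<times> int) list"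

definition orbifold_euler :: "seifert \<Rightarrow> real" where
  "orbifold_euler \<Gamma> = - of_int (b0 \<Gamma>) + (\<Sum>(\<alpha>, \<omega>)\<leftarrow>legs \<Gamma>. of_int \<omega> / of_int \<alpha>)"

text \<open>Negativity of the orbifold Euler number expresses that the plumbing graph is negative
  definite.\<close>

definition SSR_graph :: "seifert \<Rightarrow> bool" where
  "SSR_graph \<Gamma> \<longleftrightarrow>
     b0 \<Gamma> > 0 \<and> length (legs \<Gamma>) \<ge> 3 \<and>
     (\<forall>(\<alpha>, \<omega>)\<in>set (legs \<Gamma>). 0 < \<omega> \<and> \<omega> < \<alpha> \<and> coprime \<alpha> \<omega>) \<and>
     orbifold_euler \<Gamma> < 0"

definition quasi_linear :: "seifert \<Rightarrow> int \<Rightarrow> int" where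
  "quasi_linear \<Gamma> l =
     b0 \<Gamma> * l - (\<Sum>(\<alpha>, \<omega>)\<leftarrow>legs \<Gamma>. \<lceil>of_int (l * \<omega>) / of_int \<alpha> :: real\<rceil>)"

definition graph_semigroup :: "seifert \<Rightarrow> int set" where
  "graph_semigroup \<Gamma> = {l. quasi_linear \<Gamma> l \<ge> 0}"

text \<open>
  Representability is taken in its combinatorial form. By Pinkham's theorem it is equivalent to
  \<open>S\<close> being the set of degrees of the nonzero homogeneous components of the coordinate ring of
  a normal weighted homogeneous surface singularity whose link is a rational homology sphere.
  The set \<open>graph_semigroup \<Gamma>\<close> consists of integers, so \<open>S\<close> is compared with it through its
  image in the integers.
\<close>

definition representable :: "nat set \<Rightarrow> bool" where
  "representable S \<longleftrightarrow>
     numerical_semigroup S \<and> (\<exists>\<Gamma>. SSR_graph \<Gamma> \<and> int ` S = graph_semigroup \<Gamma>)"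

definition quotient_semigroup :: "nat set \<Rightarrow> nat \<Rightarrow> nat set" where
  "quotient_semigroup S k = {l. k * l \<in> S}"

end

theory Submission
  imports Defs
begin

text \<open>
  Splitting \<open>k \<omega>\<^sub>i / \<alpha>\<^sub>i\<close> into integer and fractional part shows that \<open>l \<mapsto> N(k l)\<close> is again a
  quasi-linear function, with Euler number \<open>k e < 0\<close>; but legs with \<open>\<alpha>\<^sub>i\<close> dividing \<open>k \<omega>\<^sub>i\<close>
  vanish, so fewer than three may be left. Raising \<open>b\<^sub>0\<close> by one and attaching a leg \<open>(a, a - 1)\<close>
  adds \<open>\<lfloor>l / a\<rfloor>\<close> to \<open>N(l)\<close> and lowers \<open>e\<close> by \<open>1 / a\<close>. If \<open>a\<close> exceeds every gap and no negative
  number is in the semigroup, this leaves the semigroup unchanged, so three such legs can be added.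
\<close>

text \<open>Here \<open>r / \<alpha>\<close> is the fractional part of
  \<open>k * \<omega> / \<alpha>\<close>, and dividing by \<open>g\<close> restores coprimality. If
  \<alpha> divides \<open>k * \<omega>\<close>, the result is the degenerate pair
  \<open>(1, 0)\<close>, which is no admissible leg.\<close>

definition scale_leg :: "int \<Rightarrow> int \<times> int \<Rightarrow> int \<times> int" where
  "scale_leg k = (\<lambda>(\<alpha>, \<omega>). let r = k * \<omega> mod \<alpha>; g = gcd \<alpha> r in (\<alpha> div g, r div g))"

text \<open>The sum in \<open>b0\<close> runs over all legs, also over those that the filter drops:
  a leg whose fractional part vanishes still contributes its integer part.\<close>

definition scale_seifert :: "int \<Rightarrow> seifert \<Rightarrow> seifert" where
  "scale_seifert k \<Gamma> =
     \<lparr>b0 = k * b0 \<Gamma> - (\<Sum>(\<alpha>, \<omega>)\<leftarrow>legs \<Gamma>. k * \<omega> div \<alpha>),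
      legs = map (scale_leg k) (filter (\<lambda>(\<alpha>, \<omega>). \<not> \<alpha> dvd k * \<omega>) (legs \<Gamma>))\<rparr>"

definition pad_seifert :: "int \<Rightarrow> seifert \<Rightarrow> seifert" where
  "pad_seifert a \<Gamma> = \<lparr>b0 = b0 \<Gamma> + 3, legs = replicate 3 (a, a - 1) @ legs \<Gamma>\<rparr>"

definition normalized_leg :: "int \<times> int \<Rightarrow> bool" where
  "normalized_leg = (\<lambda>(\<alpha>, \<omega>). 0 < \<omega> \<and> \<omega> < \<alpha> \<and> coprime \<alpha> \<omega>)"

lemma scale_leg_ratio:
  assumes "\<alpha> > 0" and "scale_leg k (\<alpha>, \<omega>) = (\<alpha>', \<omega>')"
  shows "of_int (k * \<omega>) / of_int \<alpha> = of_int (k * \<omega> div \<alpha>) + (of_int \<omega>' / of_int \<alpha>' :: real)"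
proof -
  define r where "r = k * \<omega> mod \<alpha>"
  define g where "g = gcd \<alpha> r"
  have g: "g > 0" using assms(1) by (simp add: g_def)
  have "\<alpha>' = \<alpha> div g" "\<omega>' = r div g"
    using assms(2) by (auto simp: scale_leg_def Let_def r_def g_def)
  then have "\<alpha> = g * \<alpha>'" "r = g * \<omega>'" by (simp_all add: g_def)
  then have "(of_int \<omega>' / of_int \<alpha>' :: real) = of_int r / of_int \<alpha>" using g by simp
  moreover have "(of_int (k * \<omega>) :: real) = of_int (k * \<omega> div \<alpha>) * of_int \<alpha> + of_int r"
    unfolding r_def of_int_mult[symmetric] of_int_add[symmetric] by simp
  ultimately show ?thesis using assms(1) by (simp add: field_simps)
qed

lemma scale_leg_ratio_dvd:
  assumes "\<alpha> > 0" and "\<alpha> dvd k * \<omega>"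
  shows "of_int (k * \<omega>) / of_int \<alpha> = (of_int (k * \<omega> div \<alpha>) :: real)"
  using assms(2) by (rule real_of_int_div[symmetric])

text \<open>Non-divisibility is exactly what makes the remainder \<open>r\<close> positive; the
  bounds \<open>0 < r < \<alpha>\<close> survive division by the positive common divisor
  \<open>g\<close>.\<close>

lemma normalized_scale_leg:
  assumes "\<alpha> > 0" and "\<not> \<alpha> dvd k * \<omega>"
  shows "normalized_leg (scale_leg k (\<alpha>, \<omega>))"
proof -
  define r where "r = k * \<omega> mod \<alpha>"
  define g where "g = gcd \<alpha> r"
  have r: "0 < r" "r < \<alpha>"
    using assms pos_mod_bound[of \<alpha> "k * \<omega>"] pos_mod_sign[of \<alpha> "k * \<omega>"]
    by (simp_all add: r_def dvd_eq_mod_eq_0 order_less_le)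
  have g: "g > 0" using assms(1) by (simp add: g_def)
  have eqs: "\<alpha> = g * (\<alpha> div g)" "r = g * (r div g)" by (simp_all add: g_def)
  have "0 < r div g" using r(1) g eqs(2) by (metis zero_less_mult_pos)
  moreover have "r div g < \<alpha> div g" using r(2) g eqs by (metis mult_less_cancel_left_pos)
  moreover have "coprime (\<alpha> div g) (r div g)"
    using assms(1) unfolding g_def by (intro div_gcd_coprime) simp
  ultimately show ?thesis
    by (simp add: normalized_leg_def scale_leg_def Let_def r_def[symmetric] g_def[symmetric])
qed

lemma normalized_legs_scale_seifert:
  assumes "\<forall>(\<alpha>, \<omega>)\<in>set (legs \<Gamma>). \<alpha> > 0"
  shows "\<forall>x\<in>set (legs (scale_seifert k \<Gamma>)). normalized_leg x"
  using assms normalized_scale_leg by (fastforce simp: scale_seifert_def)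

text \<open>The integer parts removed from the leg fractions are those subtracted from
  \<open>k * b0 \<Gamma>\<close>, so they cancel in the Euler number.\<close>

lemma orbifold_euler_scale_seifert:
  assumes "\<forall>(\<alpha>, \<omega>)\<in>set (legs \<Gamma>). \<alpha> > 0"
  shows "orbifold_euler (scale_seifert k \<Gamma>) = of_int k * orbifold_euler \<Gamma>"
proof -
  have "of_int k * (\<Sum>(\<alpha>, \<omega>)\<leftarrow>L. of_int \<omega> / of_int \<alpha> :: real)
      = of_int (\<Sum>(\<alpha>, \<omega>)\<leftarrow>L. k * \<omega> div \<alpha>)
        + (\<Sum>(\<alpha>, \<omega>)\<leftarrow>map (scale_leg k) (filter (\<lambda>(\<alpha>, \<omega>). \<not> \<alpha> dvd k * \<omega>) L).
             of_int \<omega> / of_int \<alpha>)"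
    if "\<forall>(\<alpha>, \<omega>)\<in>set L. \<alpha> > 0" for L
    using that
  proof (induction L)
    case (Cons x L)
    obtain \<alpha> \<omega> where x: "x = (\<alpha>, \<omega>)" by (cases x)
    obtain \<alpha>' \<omega>' where s: "scale_leg k (\<alpha>, \<omega>) = (\<alpha>', \<omega>')" by fastforce
    have pos: "\<alpha> > 0" using Cons.prems x by auto
    show ?case
      using Cons scale_leg_ratio[OF pos s] scale_leg_ratio_dvd[OF pos, of k \<omega>]
      by (auto simp: x s distrib_left)
  qed simp
  from this[OF assms] show ?thesis
    by (simp add: orbifold_euler_def scale_seifert_def algebra_simps)
qed

text \<open>An integer part \<open>n\<close> of a leg fraction contributes the integer
  \<open>l * n\<close>, which can be pulled out of the ceiling and absorbed into the linear term.
  Legs without fractional part leave nothing else behind.\<close>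

lemma quasi_linear_scale_seifert:
  assumes "\<forall>(\<alpha>, \<omega>)\<in>set (legs \<Gamma>). \<alpha> > 0"
  shows "quasi_linear (scale_seifert k \<Gamma>) l = quasi_linear \<Gamma> (k * l)"
proof -
  have "(\<Sum>(\<alpha>, \<omega>)\<leftarrow>L. \<lceil>of_int (k * l * \<omega>) / of_int \<alpha> :: real\<rceil>)
      = l * (\<Sum>(\<alpha>, \<omega>)\<leftarrow>L. k * \<omega> div \<alpha>)
        + (\<Sum>(\<alpha>, \<omega>)\<leftarrow>map (scale_leg k) (filter (\<lambda>(\<alpha>, \<omega>). \<not> \<alpha> dvd k * \<omega>) L).
             \<lceil>of_int (l * \<omega>) / of_int \<alpha> :: real\<rceil>)"
    if "\<forall>(\<alpha>, \<omega>)\<in>set L. \<alpha> > 0" for L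
    using that
  proof (induction L)
    case (Cons x L)
    obtain \<alpha> \<omega> where x: "x = (\<alpha>, \<omega>)" by (cases x)
    obtain \<alpha>' \<omega>' where s: "scale_leg k (\<alpha>, \<omega>) = (\<alpha>', \<omega>')" by fastforce
    have pos: "\<alpha> > 0" using Cons.prems x by auto
    have split: "of_int (k * l * \<omega>) / of_int \<alpha> = of_int l * (of_int (k * \<omega>) / of_int \<alpha> :: real)"
      by simp
    have leg: "\<lceil>of_int (k * l * \<omega>) / of_int \<alpha> :: real\<rceil>
        = l * (k * \<omega> div \<alpha>) + \<lceil>of_int (l * \<omega>') / of_int \<alpha>' :: real\<rceil>"
    proof -
      have "of_int (k * l * \<omega>) / of_int \<alpha>
          = of_int (l * (k * \<omega> div \<alpha>)) + (of_int (l * \<omega>') / of_int \<alpha>' :: real)"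
        unfolding split scale_leg_ratio[OF pos s] by (simp add: distrib_left)
      then show ?thesis by (metis ceiling_add_of_int add.commute)
    qed
    have leg_dvd: "\<lceil>of_int (k * l * \<omega>) / of_int \<alpha> :: real\<rceil> = l * (k * \<omega> div \<alpha>)"
      if "\<alpha> dvd k * \<omega>"
      unfolding split scale_leg_ratio_dvd[OF pos that] of_int_mult[symmetric] ceiling_of_int ..
    have IH: "(\<Sum>(\<alpha>, \<omega>)\<leftarrow>L. \<lceil>of_int (k * l * \<omega>) / of_int \<alpha> :: real\<rceil>)
      = l * (\<Sum>(\<alpha>, \<omega>)\<leftarrow>L. k * \<omega> div \<alpha>)
        + (\<Sum>(\<alpha>, \<omega>)\<leftarrow>map (scale_leg k) (filter (\<lambda>(\<alpha>, \<omega>). \<not> \<alpha> dvd k * \<omega>) L).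
             \<lceil>of_int (l * \<omega>) / of_int \<alpha> :: real\<rceil>)"
      using Cons by simp
    show ?case
      using IH leg leg_dvd by (cases "\<alpha> dvd k * \<omega>") (simp_all add: x s distrib_left del: of_int_mult)
  qed simp
  from this[OF assms] show ?thesis
    by (simp add: quasi_linear_def scale_seifert_def algebra_simps)
qed

lemma orbifold_euler_pad_seifert:
  assumes "a > 0"
  shows "orbifold_euler (pad_seifert a \<Gamma>) = orbifold_euler \<Gamma> - 3 / of_int a"
  using assms by (simp add: orbifold_euler_def pad_seifert_def numeral_3_eq_3 field_simps)

text \<open>Since \<open>l * (a - 1) / a = l - l / a\<close>, the ceiling for one new leg is
  \<open>l - l div a\<close>. The unit added to \<open>b0\<close> for that leg cancels the
  \<open>l\<close>.\<close>

lemma quasi_linear_pad_seifert: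
  assumes "a > 0"
  shows "quasi_linear (pad_seifert a \<Gamma>) l = quasi_linear \<Gamma> l + 3 * (l div a)"
proof -
  have "of_int (l * (a - 1)) / of_int a = - (of_int l / of_int a) + (of_int l :: real)"
    using assms by (simp add: field_simps)
  then have "\<lceil>of_int (l * (a - 1)) / of_int a :: real\<rceil> = l - l div a"
    by (simp only: ceiling_add_of_int ceiling_minus floor_divide_of_int_eq)
  then show ?thesis
    by (simp add: quasi_linear_def pad_seifert_def numeral_3_eq_3 algebra_simps
        del: of_int_mult of_int_diff)
qed

text \<open>\<open>SSR_graph\<close> demands a positive \<open>b0\<close>, which the subtraction in
  \<open>scale_seifert\<close> leaves unclear. It follows from negative definiteness because the leg
  fractions are nonnegative.\<close>

lemma b0_pos:
  assumes "\<forall>x\<in>set (legs \<Gamma>). normalized_leg x" and "orbifold_euler \<Gamma> < 0"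
  shows "b0 \<Gamma> > 0"
proof -
  have "0 \<le> (\<Sum>(\<alpha>, \<omega>)\<leftarrow>legs \<Gamma>. of_int \<omega> / of_int \<alpha> :: real)"
    using assms(1) by (intro sum_list_nonneg) (auto simp: normalized_leg_def)
  then have "(0 :: real) < of_int (b0 \<Gamma>)"
    using assms(2) by (simp add: orbifold_euler_def)
  then show ?thesis by simp
qed

lemma SSR_graph_pad_seifert:
  assumes "\<forall>x\<in>set (legs \<Gamma>). normalized_leg x" and "orbifold_euler \<Gamma> < 0" and "a > 1"
  shows "SSR_graph (pad_seifert a \<Gamma>)"
proof -
  have "orbifold_euler (pad_seifert a \<Gamma>) < 0"
    using assms(2,3) orbifold_euler_pad_seifert[of a \<Gamma>]
    by (smt (verit) divide_nonneg_nonneg of_int_0_le_iff)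
  moreover have "coprime a (a - 1)"
    using coprime_add_one_left[of "a - 1"] by simp
  ultimately show ?thesis
    using assms b0_pos[OF assms(1,2)]
    by (auto simp: SSR_graph_def pad_seifert_def normalized_leg_def)
qed

text \<open>The added term never changes the sign condition: it is negative for
  \<open>l < 0\<close>, where \<open>quasi_linear\<close> is negative already; zero for
  \<open>0 \<le> l < a\<close>; and positive from \<open>a\<close> on, where
  \<open>quasi_linear\<close> is already nonnegative.\<close>

lemma graph_semigroup_pad_seifert:
  assumes "a > 0" and "graph_semigroup \<Gamma> \<subseteq> {0..}" and "{a..} \<subseteq> graph_semigroup \<Gamma>"
  shows "graph_semigroup (pad_seifert a \<Gamma>) = graph_semigroup \<Gamma>"
proof -
  have "quasi_linear \<Gamma> l + 3 * (l div a) \<ge> 0 \<longleftrightarrow> quasi_linear \<Gamma> l \<ge> 0" for l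
  proof -
    consider "l < 0" | "0 \<le> l" "l < a" | "l \<ge> a" by linarith
    then show ?thesis
    proof cases
      case 1
      then have "l \<notin> graph_semigroup \<Gamma>" using assms(2) by auto
      then have "quasi_linear \<Gamma> l < 0" by (simp add: graph_semigroup_def)
      moreover have "l div a < 0" using 1 assms(1) by (rule div_neg_pos_less0)
      ultimately show ?thesis by linarith
    next
      case 2
      then show ?thesis by simp
    next
      case 3
      then have "quasi_linear \<Gamma> l \<ge> 0" using assms(3) by (auto simp: graph_semigroup_def)
      moreover have "l div a \<ge> 0" using 3 assms(1) by (simp add: pos_imp_zdiv_nonneg_iff)
      ultimately show ?thesis by linarith
    qed
  qed
  then show ?thesis
    using assms(1) by (simp add: graph_semigroup_def quasi_linear_pad_seifert)
qed

text \<open>The gaps of the quotient are the preimage of the gaps of \<open>S\<close> under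
  multiplication by \<open>k\<close>, which is injective as \<open>k \<ge> 1\<close>.\<close>

lemma numerical_semigroup_quotient:
  assumes "numerical_semigroup S" and "k \<ge> 1"
  shows "numerical_semigroup (quotient_semigroup S k)"
proof -
  have "inj ((*) k)" using assms(2) by (simp add: inj_on_def)
  then have "finite ((*) k -` (UNIV - S))"
    using assms(1) by (intro finite_vimageI) (simp_all add: numerical_semigroup_def)
  moreover have "UNIV - quotient_semigroup S k = (*) k -` (UNIV - S)"
    by (auto simp: quotient_semigroup_def)
  ultimately show ?thesis
    using assms(1) by (simp add: numerical_semigroup_def quotient_semigroup_def distrib_left)
qed

theorem lemma3p3p1:
  fixes S :: "nat set" and k :: nat
  assumes "representable S" and "k \<ge> 1"
  shows "representable (quotient_semigroup S k)"
proof -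
  let ?Q = "quotient_semigroup S k"
  obtain \<Gamma> where \<Gamma>: "SSR_graph \<Gamma>" and S: "int ` S = graph_semigroup \<Gamma>"
    and "numerical_semigroup S"
    using assms(1) by (auto simp: representable_def)
  then have Q: "numerical_semigroup ?Q" using assms(2) numerical_semigroup_quotient by blast
  \<comment> \<open>\<Delta> already has the right semigroup but possibly fewer than three legs.
    Hence only normalized legs and a negative Euler number are shown for it, and
    \<open>SSR_graph\<close> only after padding.\<close>
  define \<Delta> where "\<Delta> = scale_seifert (int k) \<Gamma>"
  have pos: "\<forall>(\<alpha>, \<omega>)\<in>set (legs \<Gamma>). \<alpha> > 0"
    using \<Gamma> by (fastforce simp: SSR_graph_def)
  have legs: "\<forall>x\<in>set (legs \<Delta>). normalized_leg x"
    unfolding \<Delta>_def by (rule normalized_legs_scale_seifert[OF pos])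
  have euler: "orbifold_euler \<Delta> < 0"
    using \<Gamma> assms(2)
    by (simp add: \<Delta>_def orbifold_euler_scale_seifert[OF pos] SSR_graph_def mult_pos_neg)
  have mem: "l \<in> graph_semigroup \<Delta> \<longleftrightarrow> int k * l \<in> int ` S" for l
    by (simp add: S \<Delta>_def graph_semigroup_def quasi_linear_scale_seifert[OF pos])
  have \<Delta>: "graph_semigroup \<Delta> = int ` ?Q"
  proof (intro set_eqI iffI)
    fix l assume "l \<in> graph_semigroup \<Delta>"
    then obtain s where s: "s \<in> S" "int k * l = int s" using mem by auto
    then have "l \<ge> 0" using assms(2) by (smt (verit) mult_pos_neg of_nat_0_le_iff of_nat_1 of_nat_mono)
    then obtain n where n: "l = int n" using nonneg_int_cases by blast
    then have "k * n = s" using s(2) by (metis of_nat_eq_iff of_nat_mult)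
    then show "l \<in> int ` ?Q" using s(1) n by (auto simp: quotient_semigroup_def)
  next
    fix l assume "l \<in> int ` ?Q"
    then show "l \<in> graph_semigroup \<Delta>" unfolding mem by (auto simp: quotient_semigroup_def simp flip: of_nat_mult)
  qed
  obtain m where m: "\<forall>n\<in>UNIV - ?Q. n < m"
    using Q finite_nat_set_iff_bounded by (auto simp: numerical_semigroup_def)
  \<comment> \<open>Besides exceeding every gap, \<open>a\<close> must be at least 2 for
    \<open>(a, a - 1)\<close> to be an admissible leg; the summand 2 ensures this even when
    \<open>m = 0\<close>.\<close>
  define a where "a = int m + 2"
  have "{a..} \<subseteq> graph_semigroup \<Delta>"
  proof
    fix l assume l: "l \<in> {a..}"
    then have "\<not> nat l < m" by (simp add: a_def)
    then have "nat l \<in> ?Q" using m by blast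
    then have "int (nat l) \<in> int ` ?Q" by (rule imageI)
    then show "l \<in> graph_semigroup \<Delta>" using l by (simp add: \<Delta> a_def)
  qed
  moreover have "graph_semigroup \<Delta> \<subseteq> {0..}" by (auto simp: \<Delta>)
  ultimately have "graph_semigroup (pad_seifert a \<Delta>) = int ` ?Q"
    using graph_semigroup_pad_seifert[of a \<Delta>] \<Delta> by (simp add: a_def)
  moreover have "SSR_graph (pad_seifert a \<Delta>)"
    by (rule SSR_graph_pad_seifert[OF legs euler]) (simp add: a_def)
  ultimately show ?thesis using Q unfolding representable_def by metis
qed

end
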